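(* Let $\mathcal{A}$ be an irreducible compact family of real $d\times d$ matrices that possesses an invariant cone. Then $\mathcal{A}$ has both a minimal invariant cone $K_{\min}(\mathcal{A})$ and a maximal invariant cone $K_{\max}(\mathcal{A})$. Moreover, $K_{\max}(\mathcal{A})=[K_{\min}(\mathcal{A}^T)]^*$ (where the minimal and maximal cones are determined up to replacing a cone by its opposite).
   Context: A cone $K\subset\mathbb{R}^d$ is a closed convex cone with apex at the origin that is proper, i.e. it has nonempty interior and $K\cap(-K)=\{0\}$. $K$ is an invariant cone of $\mathcal{A}$ if $AK\subset K$ for all $A\in\mathcal{A}$. A family is irreducible if its matrices have no common invariant linear subspace other than $\{0\}$ and $\mathbb{R}^d$. An invariant cone $K$ of $\mathcal{A}$ is minimal if for every invariant cone $K'$ of $\mathcal{A}$ either $K\subset K'$ or $K\subset -K'$. It is maximal if for every invariant cone $K'$ of $\mathcal{A}$ either $K'\subset K$ or $-K'\subset K$. $\mathcal{A}^T=\{A^T: A\in\mathcal{A}\}$, and $K^*=\{x\in\mathbb{R}^d:\ (x,y)\ge 0\ \text{for all } y\in K\}$ is the dual cone. *)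

theory Defs
  imports "HOL-Analysis.Analysis"
begin

definition proper_cone :: "(real ^ 'd) set \<Rightarrow> bool" where
  "proper_cone K \<longleftrightarrow>
     closed K \<and> convex_cone K \<and> interior K \<noteq> {} \<and> K \<inter> uminus ` K = {0}"

definition invariant_cone :: "(real ^ 'd ^ 'd) set \<Rightarrow> (real ^ 'd) set \<Rightarrow> bool" where
  "invariant_cone \<A> K \<longleftrightarrow> proper_cone K \<and> (\<forall>A\<in>\<A>. (\<lambda>x. A *v x) ` K \<subseteq> K)"

definition irreducible_family :: "(real ^ 'd ^ 'd) set \<Rightarrow> bool" where
  "irreducible_family \<A> \<longleftrightarrow>
     (\<forall>V. subspace V \<and> (\<forall>A\<in>\<A>. (\<lambda>x. A *v x) ` V \<subseteq> V) \<longrightarrow> V = {0} \<or> V = UNIV)"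

definition minimal_invariant_cone :: "(real ^ 'd ^ 'd) set \<Rightarrow> (real ^ 'd) set \<Rightarrow> bool" where
  "minimal_invariant_cone \<A> K \<longleftrightarrow>
     invariant_cone \<A> K \<and>
     (\<forall>K'. invariant_cone \<A> K' \<longrightarrow> K \<subseteq> K' \<or> K \<subseteq> uminus ` K')"

definition maximal_invariant_cone :: "(real ^ 'd ^ 'd) set \<Rightarrow> (real ^ 'd) set \<Rightarrow> bool" where
  "maximal_invariant_cone \<A> K \<longleftrightarrow>
     invariant_cone \<A> K \<and>
     (\<forall>K'. invariant_cone \<A> K' \<longrightarrow> K' \<subseteq> K \<or> uminus ` K' \<subseteq> K)"

definition dual_cone :: "(real ^ 'd) set \<Rightarrow> (real ^ 'd) set" where
  "dual_cone K = {x. \<forall>y\<in>K. 0 \<le> x \<bullet> y}"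

end

theory Submission
  imports Defs
begin

text \<open>
  A smallest cone exists because all invariant cones share, up to sign, a nonzero vector \<open>v\<close>:
  the intersection of the invariant cones that contain \<open>v\<close> is then contained in every
  invariant cone or in its opposite, and irreducibility makes it span the whole space, so that it
  is itself proper.

  The common vector comes from Perron--Frobenius theory. Pick a finite subfamily \<open>F\<close> with the same
  linear span as the given family; having the same invariant subspaces, \<open>F\<close> is irreducible too.
  The sum \<open>T\<close> of the matrices in \<open>F\<close> maps every invariant cone into itself, so Brouwer's
  theorem gives it an eigenvector in each of them (\<open>Perron_eigenvector_exists\<close>). By
  irreducibility such an eigenvector is an order unit of its cone
  (\<open>Perron_eigenvector_order_unit\<close>), and this forces its eigenvalue to dominate any other
  nonnegative eigenvalue of \<open>T\<close> and to be simple in the geometric sense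
  (\<open>Perron_eigenvalue_dominates\<close>). Applied to two invariant cones in both directions, this shows
  that their Perron eigenvectors are proportional.

  Maximal cones are obtained by duality: \<open>K \<mapsto> K\<^sup>*\<close> is an inclusion-reversing
  bijection between the invariant cones of the family and those of the transposed family,
  it commutes with taking opposites, and it therefore exchanges minimal with
  maximal cones (\<open>maximal_iff_dual_minimal\<close>).
\<close>

section \<open>Proper cones\<close>

lemma mem_uminus_image: "x \<in> uminus ` K \<longleftrightarrow> - x \<in> K"
  for x :: "'a :: group_add"
  by (metis image_iff minus_minus)

lemma uminus_image_subset_iff: "uminus ` K \<subseteq> L \<longleftrightarrow> K \<subseteq> uminus ` L"
  for K :: "'a :: group_add set"
  by (auto simp: mem_uminus_image)

text \<open>
  The relative interior of a nonempty convex set is nonempty. The affine hull of a cone is its span,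
  so for a spanning cone relative interior and interior agree.
\<close>

lemma interior_convex_cone_nonempty:
  fixes K :: "'a :: euclidean_space set"
  assumes K: "convex_cone K" and span: "span K = UNIV"
  shows "interior K \<noteq> {}"
proof -
  have "affine hull K = UNIV"
    using convex_cone_contains_0[OF K] span by (metis affine_hull_span_0 hull_inc)
  then show ?thesis
    using K rel_interior_interior rel_interior_eq_empty
    by (metis convex_cone_def)
qed

lemma proper_cone_closed: "proper_cone K \<Longrightarrow> closed K"
  and proper_cone_convex_cone: "proper_cone K \<Longrightarrow> convex_cone K"
  by (auto simp: proper_cone_def)

lemma proper_cone_pointed:
  assumes "proper_cone K" "x \<in> K" "- x \<in> K"
  shows "x = 0"
proof -
  have "x \<in> K \<inter> uminus ` K" using assms(2,3) by (simp add: mem_uminus_image)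
  moreover have "K \<inter> uminus ` K = {0}" using assms(1) by (simp only: proper_cone_def)
  ultimately show ?thesis by simp
qed

lemma proper_cone_nontrivial:
  assumes "proper_cone K"
  obtains x where "x \<in> K" "x \<noteq> 0"
proof -
  have "interior K \<noteq> {}" using assms by (simp add: proper_cone_def)
  then have "\<not> K \<subseteq> {0}" using interior_mono[of K "{0}"] by auto
  then show ?thesis using that by blast
qed

lemma proper_coneI:
  assumes "closed K" "convex_cone K" "span K = UNIV"
    and "\<And>x. x \<in> K \<Longrightarrow> - x \<in> K \<Longrightarrow> x = 0"
  shows "proper_cone K"
  unfolding proper_cone_def
  using assms interior_convex_cone_nonempty convex_cone_contains_0[of K]
  by (auto simp: mem_uminus_image)

lemma proper_cone_uminus: "proper_cone K \<Longrightarrow> proper_cone (uminus ` K)"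
  unfolding proper_cone_def
  by (auto simp: closed_negations interior_negations convex_cone_linear_image
      linear_uminus image_image)

lemma invariant_cone_proper: "invariant_cone \<A> K \<Longrightarrow> proper_cone K"
  and invariant_cone_mult: "invariant_cone \<A> K \<Longrightarrow> A \<in> \<A> \<Longrightarrow> x \<in> K \<Longrightarrow> A *v x \<in> K"
  by (auto simp: invariant_cone_def)

lemma invariant_coneI:
  "proper_cone K \<Longrightarrow> (\<And>A x. A \<in> \<A> \<Longrightarrow> x \<in> K \<Longrightarrow> A *v x \<in> K) \<Longrightarrow> invariant_cone \<A> K"
  by (auto simp: invariant_cone_def)

lemma matrix_vector_mult_uminus: "A *v (- x) = - (A *v x)" for A :: "real ^ 'n ^ 'm"
  using matrix_vector_mult_diff_distrib[of A 0 x] by simp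

lemma invariant_cone_uminus: "invariant_cone \<A> K \<Longrightarrow> invariant_cone \<A> (uminus ` K)"
  by (auto intro!: invariant_coneI proper_cone_uminus dest: invariant_cone_mult
      simp: invariant_cone_proper matrix_vector_mult_uminus)

lemma irreducible_familyD:
  assumes "irreducible_family \<A>" "subspace V"
    and "\<And>A x. A \<in> \<A> \<Longrightarrow> x \<in> V \<Longrightarrow> A *v x \<in> V"
  shows "V = {0} \<or> V = UNIV"
proof -
  have "\<forall>A\<in>\<A>. (*v) A ` V \<subseteq> V" using assms(3) by (intro ballI image_subsetI)
  with assms(1,2) show ?thesis unfolding irreducible_family_def by simp
qed

lemma irreducible_familyI:
  assumes "\<And>V. subspace V \<Longrightarrow> (\<And>A x. A \<in> \<A> \<Longrightarrow> x \<in> V \<Longrightarrow> A *v x \<in> V) \<Longrightarrow> V = {0} \<or> V = UNIV"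
  shows "irreducible_family \<A>"
  unfolding irreducible_family_def
proof (intro allI impI, elim conjE)
  fix V assume "subspace V" and inv: "\<forall>A\<in>\<A>. (*v) A ` V \<subseteq> V"
  have "A *v x \<in> V" if "A \<in> \<A>" "x \<in> V" for A x
    using bspec[OF inv that(1)] imageI[OF that(2)] by (rule subsetD)
  with \<open>subspace V\<close> show "V = {0} \<or> V = UNIV" by (rule assms)
qed

section \<open>Duality\<close>

lemma closed_dual_cone: "closed (dual_cone K)"
proof -
  have "dual_cone K = (\<Inter>y\<in>K. {x. y \<bullet> x \<ge> 0})"
    by (auto simp: dual_cone_def inner_commute)
  then show ?thesis by (simp add: closed_halfspace_ge closed_INT)
qed

lemma convex_cone_dual_cone: "convex_cone (dual_cone K)"
  by (auto simp: convex_cone_iff dual_cone_def inner_left_distrib)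

lemma dual_cone_antimono: "K \<subseteq> L \<Longrightarrow> dual_cone L \<subseteq> dual_cone K"
  by (auto simp: dual_cone_def)

lemma dual_cone_uminus: "dual_cone (uminus ` K) = uminus ` dual_cone K"
  by (auto simp: dual_cone_def mem_uminus_image)

text \<open>
  The bipolar theorem for cones: a point outside \<open>K\<close> is separated from \<open>K\<close> by a hyperplane,
  and since \<open>K\<close> is closed under scaling the normal vector of that hyperplane lies in the dual cone.
\<close>

lemma dual_dual_cone:
  assumes "closed K" "convex_cone K"
  shows "dual_cone (dual_cone K) = K"
proof
  show "K \<subseteq> dual_cone (dual_cone K)"
    by (auto simp: dual_cone_def inner_commute)
  show "dual_cone (dual_cone K) \<subseteq> K"
  proof (rule subsetI, rule ccontr)
    fix z assume z: "z \<in> dual_cone (dual_cone K)" and "z \<notin> K"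
    then obtain a b where ab: "a \<bullet> z < b" "\<And>x. x \<in> K \<Longrightarrow> a \<bullet> x > b"
      using separating_hyperplane_closed_point[of K z] assms
      by (auto simp: convex_cone_def)
    have "b < 0" using ab(2)[OF convex_cone_contains_0[OF assms(2)]] by simp
    have "a \<in> dual_cone K"
      unfolding dual_cone_def
    proof (safe, rule ccontr)
      fix y assume y: "y \<in> K" "\<not> 0 \<le> a \<bullet> y"
      \<comment> \<open>The multiple of \<open>y\<close> that lies on the separating hyperplane is in \<open>K\<close>.\<close>
      have "(b / (a \<bullet> y)) *\<^sub>R y \<in> K"
        using y \<open>b < 0\<close> assms(2) by (intro convex_cone_scaleR) (auto simp: divide_simps)
      from ab(2)[OF this] y(2) show False by simp
    qed
    then have "0 \<le> a \<bullet> z" using z by (auto simp: dual_cone_def inner_commute)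
    then show False using ab \<open>b < 0\<close> by simp
  qed
qed

text \<open>
  Pointedness and solidity are dual to each other. A vector orthogonal to the whole dual cone lies,
  together with its opposite, in \<open>K\<^sup>*\<^sup>* = K\<close>, so it vanishes because \<open>K\<close> is pointed; hence
  \<open>K\<^sup>*\<close> spans. Conversely, a vector \<open>x\<close> with \<open>x, -x \<in> K\<^sup>*\<close> is orthogonal to \<open>K\<close>, hence to
  the small ball that \<open>K\<close> contains.
\<close>

lemma proper_cone_dual:
  assumes K: "proper_cone K"
  shows "proper_cone (dual_cone K)"
proof (rule proper_coneI)
  show "closed (dual_cone K)" "convex_cone (dual_cone K)"
    by (simp_all add: closed_dual_cone convex_cone_dual_cone)
  show "span (dual_cone K) = UNIV"
  proof (rule ccontr)
    assume "span (dual_cone K) \<noteq> UNIV"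
    then obtain a where a: "a \<noteq> 0" "\<And>x. x \<in> dual_cone K \<Longrightarrow> a \<bullet> x = 0"
      using span_not_univ_subset_hyperplane[of "dual_cone K"] span_base by blast
    then have "a \<in> dual_cone (dual_cone K)" "- a \<in> dual_cone (dual_cone K)"
      by (auto simp: dual_cone_def)
    then have "a \<in> K" "- a \<in> K"
      using dual_dual_cone[OF proper_cone_closed[OF K] proper_cone_convex_cone[OF K]] by simp_all
    with proper_cone_pointed[OF K] a(1) show False by blast
  qed
  fix x assume x: "x \<in> dual_cone K" "- x \<in> dual_cone K"
  then have zero: "x \<bullet> y = 0" if "y \<in> K" for y
    using that by (force simp: dual_cone_def)
  obtain c where "c \<in> interior K" using K by (auto simp: proper_cone_def)
  then obtain e where e: "e > 0" "cball c e \<subseteq> K"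
    by (meson mem_interior_cball)
  have "c + (e / (norm x + 1)) *\<^sub>R x \<in> cball c e"
  proof -
    have "norm x + 1 > 0" using norm_ge_zero[of x] by linarith
    then have "e * norm x / (norm x + 1) \<le> e" using e(1)
      by (simp add: divide_le_eq)
    then show ?thesis using e(1) by (simp add: dist_norm)
  qed
  then have "c + (e / (norm x + 1)) *\<^sub>R x \<in> K" using e(2) by blast
  then have "x \<bullet> (c + (e / (norm x + 1)) *\<^sub>R x) = 0" by (rule zero)
  moreover have "c \<in> K" using e by (intro subsetD[OF e(2)]) simp
  then have "x \<bullet> c = 0" by (rule zero)
  ultimately have "(e / (norm x + 1)) * (x \<bullet> x) = 0" by (simp add: inner_right_distrib)
  moreover have "norm x + 1 \<noteq> 0" using norm_ge_zero[of x] by linarith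
  ultimately show "x = 0" using e(1) by simp
qed

lemma inner_transpose_mult: "(transpose A *v x) \<bullet> y = x \<bullet> (A *v y)"
  for A :: "real ^ 'n ^ 'm"
  by (simp add: dot_lmul_matrix)

lemma invariant_cone_dual:
  assumes "invariant_cone \<A> K"
  shows "invariant_cone (transpose ` \<A>) (dual_cone K)"
proof (rule invariant_coneI)
  show "proper_cone (dual_cone K)"
    using assms by (intro proper_cone_dual invariant_cone_proper)
  show "B *v x \<in> dual_cone K" if "B \<in> transpose ` \<A>" "x \<in> dual_cone K" for B x
    using that invariant_cone_mult[OF assms]
    by (auto simp: dual_cone_def inner_transpose_mult simp del: transpose_matrix_vector)
qed

text \<open>
  The orthogonal complement of an invariant subspace of the transposed family is invariant under
  the family itself.
\<close>

lemma irreducible_family_transpose: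
  assumes irr: "irreducible_family \<A>"
  shows "irreducible_family (transpose ` \<A>)"
proof (rule irreducible_familyI)
  fix V assume V: "subspace V"
    and inv: "\<And>A x. A \<in> transpose ` \<A> \<Longrightarrow> x \<in> V \<Longrightarrow> A *v x \<in> V"
  define W where "W = {y. \<forall>x\<in>V. orthogonal x y}"
  have "subspace W" unfolding W_def by (rule subspace_orthogonal_to_vectors)
  moreover have "A *v y \<in> W" if A: "A \<in> \<A>" and y: "y \<in> W" for A y
  proof -
    have "x \<bullet> (A *v y) = 0" if "x \<in> V" for x
    proof -
      have "transpose A *v x \<in> V" using imageI[OF A] that by (rule inv)
      then have "(transpose A *v x) \<bullet> y = 0" using y unfolding W_def orthogonal_def by blast
      then show ?thesis unfolding inner_transpose_mult .
    qed
    then show ?thesis by (simp add: W_def orthogonal_def)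
  qed
  ultimately consider "W = {0}" | "W = UNIV"
    using irreducible_familyD[OF irr] by metis
  then show "V = {0} \<or> V = UNIV"
  proof cases
    case 1
    have "span V = UNIV"
    proof (rule ccontr)
      assume "span V \<noteq> UNIV"
      then obtain a where "a \<noteq> 0" "\<And>x. x \<in> V \<Longrightarrow> a \<bullet> x = 0"
        using span_not_univ_subset_hyperplane[of V] span_base by blast
      then have "a \<in> W" by (auto simp: W_def orthogonal_def inner_commute)
      with 1 \<open>a \<noteq> 0\<close> show False by simp
    qed
    moreover have "span V = V" using V by (simp only: span_eq_iff)
    ultimately show ?thesis by blast
  next
    case 2
    then have "x = 0" if "x \<in> V" for x
      using that orthogonal_self[of x] unfolding W_def by blast
    then show ?thesis using subspace_0[OF V] by auto
  qed
qed

section \<open>Perron eigenvectors\<close>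

text \<open>
  An interior point \<open>w\<close> of the dual cone stays in it when it is moved by a small multiple of the
  direction of \<open>-x\<close>. The bound makes the slice \<open>w \<bullet> x = 1\<close> of the cone compact.
\<close>

lemma proper_cone_positive_functional:
  assumes "proper_cone K"
  obtains w d where "d > 0" "\<And>x. x \<in> K \<Longrightarrow> w \<bullet> x \<ge> d * norm x"
proof -
  obtain w where "w \<in> interior (dual_cone K)"
    using proper_cone_dual[OF assms] by (auto simp: proper_cone_def)
  then obtain e where e: "e > 0" "cball w e \<subseteq> dual_cone K"
    by (meson mem_interior_cball)
  have "w \<bullet> x \<ge> e * norm x" if "x \<in> K" for x
  proof (cases "x = 0")
    case False
    have "w - (e / norm x) *\<^sub>R x \<in> cball w e" using e(1) False by (simp add: dist_norm)
    then have "w - (e / norm x) *\<^sub>R x \<in> dual_cone K" using e(2) by blast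
    then have "0 \<le> (w - (e / norm x) *\<^sub>R x) \<bullet> x"
      using that unfolding dual_cone_def by blast
    then show ?thesis
      using False by (simp add: inner_diff_left power2_norm_eq_inner[symmetric] power2_eq_square)
  qed simp
  with e(1) that show thesis by blast
qed

text \<open>
  Brouwer's theorem is applied to the normalisation of \<open>x + T x\<close> on a compact slice of \<open>K\<close>.
  The summand \<open>x\<close> keeps the normalising factor away from zero even where \<open>T\<close> vanishes.
\<close>

lemma Perron_eigenvector_exists:
  assumes K: "proper_cone K" and T: "linear T" and TK: "\<And>x. x \<in> K \<Longrightarrow> T x \<in> K"
  obtains v r where "v \<in> K" "v \<noteq> 0" "r \<ge> 0" "T v = r *\<^sub>R v"
proof -
  note cone = proper_cone_convex_cone[OF K]
  obtain w d where wd: "d > 0" "\<And>x. x \<in> K \<Longrightarrow> w \<bullet> x \<ge> d * norm x"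
    using proper_cone_positive_functional[OF K] by blast
  define S where "S = K \<inter> {x. w \<bullet> x = 1}"
  have "bounded S"
    unfolding bounded_iff
  proof (intro exI ballI)
    fix x assume "x \<in> S"
    then have "d * norm x \<le> 1" using wd(2)[of x] by (auto simp: S_def)
    then show "norm x \<le> 1 / d" using wd(1) by (simp add: field_simps)
  qed
  then have "compact S"
    unfolding S_def using proper_cone_closed[OF K]
    by (simp add: closed_Int closed_hyperplane compact_eq_bounded_closed)
  have "convex S"
    using cone unfolding S_def convex_cone_def by (simp add: convex_Int convex_hyperplane)
  obtain x0 where x0: "x0 \<in> K" "x0 \<noteq> 0" using proper_cone_nontrivial[OF K] .
  have "w \<bullet> x0 > 0" using wd(2)[OF x0(1)] x0(2) wd(1)
    by (smt (verit) mult_pos_pos zero_less_norm_iff)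
  then have "(1 / (w \<bullet> x0)) *\<^sub>R x0 \<in> S"
    using x0 cone by (auto simp: S_def intro!: convex_cone_scaleR)
  then have "S \<noteq> {}" by blast
  \<comment> \<open>A fixed point \<open>v\<close> of \<open>f\<close> satisfies \<open>v + T v = l v\<close> with \<open>l \<ge> 1\<close>, so the eigenvalue \<open>l - 1\<close> of \<open>T\<close> is nonnegative.\<close>
  define f where "f = (\<lambda>x. (1 / (w \<bullet> (x + T x))) *\<^sub>R (x + T x))"
  have pos: "w \<bullet> (x + T x) \<ge> 1" if "x \<in> S" for x
  proof -
    have "0 \<le> d * norm (T x)" using wd(1) by simp
    also have "\<dots> \<le> w \<bullet> T x" using that TK wd(2) by (simp add: S_def)
    finally show ?thesis using that by (simp add: S_def inner_right_distrib)
  qed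
  have contT: "continuous_on S T"
    using T by (simp add: linear_continuous_on linear_linear)
  have "continuous_on S f"
    unfolding f_def using pos by (intro continuous_intros contT) force
  moreover have "f \<in> S \<rightarrow> S"
  proof
    fix x assume x: "x \<in> S"
    then have "x + T x \<in> K" using TK cone by (auto simp: S_def intro: convex_cone_add)
    then show "f x \<in> S"
      using pos[OF x] cone by (auto simp: S_def f_def intro!: convex_cone_scaleR)
  qed
  ultimately obtain v where v: "v \<in> S" "f v = v"
    using brouwer[OF \<open>compact S\<close> \<open>convex S\<close> \<open>S \<noteq> {}\<close>] by blast
  define l where "l = w \<bullet> (v + T v)"
  have "l \<ge> 1" using pos[OF v(1)] by (simp add: l_def)
  have "l *\<^sub>R v = l *\<^sub>R f v" using v(2) by simp
  also have "\<dots> = v + T v" using \<open>l \<ge> 1\<close> by (simp add: f_def flip: l_def)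
  finally have "T v = (l - 1) *\<^sub>R v" by (simp add: algebra_simps)
  moreover have "v \<in> K" "v \<noteq> 0" using v(1) by (auto simp: S_def)
  ultimately show thesis using that[of v "l - 1"] \<open>l \<ge> 1\<close> by simp
qed

definition sum_action :: "(real ^ 'd ^ 'd) set \<Rightarrow> real ^ 'd \<Rightarrow> real ^ 'd" where
  "sum_action F x = (\<Sum>B\<in>F. B *v x)"

lemma linear_sum_action: "linear (sum_action F)"
  unfolding sum_action_def by (intro linear_compose_sum ballI matrix_vector_mul_linear)

lemma convex_cone_sum:
  assumes "convex_cone K" "\<And>i. i \<in> I \<Longrightarrow> f i \<in> K"
  shows "sum f I \<in> K"
  using assms(2)
  by (induction I rule: infinite_finite_induct)
    (simp_all add: convex_cone_add[OF assms(1)] convex_cone_contains_0[OF assms(1)])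

text \<open>
  A matrix leaves a subspace invariant whenever it is a linear combination of matrices that do.
\<close>

lemma irreducible_spanning_subset:
  assumes irr: "irreducible_family \<A>" and sp: "\<A> \<subseteq> span F"
  shows "irreducible_family F"
proof (rule irreducible_familyI)
  fix V assume V: "subspace V"
    and inv: "\<And>B x. B \<in> F \<Longrightarrow> x \<in> V \<Longrightarrow> B *v x \<in> V"
  have "A *v x \<in> V" if "A \<in> span F" "x \<in> V" for A x
    using that(1)
  proof (induction rule: span_induct_alt)
    case base
    then show ?case using subspace_0[OF V] by simp
  next
    case (step c B A)
    then show ?case using inv V that(2)
      by (auto simp: matrix_vector_mult_add_rdistrib scaleR_matrix_vector_assoc[symmetric]
          intro!: subspace_add subspace_scale)
  qed
  then show "V = {0} \<or> V = UNIV" using sp by (intro irreducible_familyD[OF irr V]) blast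
qed

text \<open>
  The vectors \<open>x\<close> with \<open>-t v \<le> x \<le> t v\<close> for some \<open>t\<close>, in the order defined by \<open>K\<close>, form a
  subspace. Each \<open>B \<in> F\<close> preserves it because \<open>B v \<le> r v\<close>, so irreducibility makes it
  the whole space.
\<close>

lemma Perron_eigenvector_order_unit:
  assumes K: "convex_cone K" and FK: "\<forall>B\<in>F. \<forall>x\<in>K. B *v x \<in> K"
    and fin: "finite F" and irr: "irreducible_family F"
    and v: "v \<in> K" "v \<noteq> 0" "r \<ge> 0" "sum_action F v = r *\<^sub>R v"
  obtains t where "t > 0" "t *\<^sub>R v + x \<in> K"
proof -
  define V where "V = {x. \<exists>t\<ge>0. t *\<^sub>R v + x \<in> K \<and> t *\<^sub>R v - x \<in> K}"
  have VI: "x \<in> V" if "t \<ge> 0" "t *\<^sub>R v + x \<in> K" "t *\<^sub>R v - x \<in> K" for t x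
    using that by (auto simp: V_def)
  have "subspace V"
  proof (rule subspaceI)
    show "0 \<in> V" using convex_cone_contains_0[OF K] VI[of 0 0] by simp
    fix x y assume "x \<in> V" "y \<in> V"
    then obtain s t where "s \<ge> 0" "s *\<^sub>R v + x \<in> K" "s *\<^sub>R v - x \<in> K"
      and "t \<ge> 0" "t *\<^sub>R v + y \<in> K" "t *\<^sub>R v - y \<in> K"
      by (auto simp: V_def)
    then have "s + t \<ge> 0" "(s *\<^sub>R v + x) + (t *\<^sub>R v + y) \<in> K" "(s *\<^sub>R v - x) + (t *\<^sub>R v - y) \<in> K"
      using K by (auto intro: convex_cone_add)
    then show "x + y \<in> V" by (intro VI[of "s + t"]) (simp_all add: algebra_simps)
  next
    fix c x assume "x \<in> V"
    then obtain t where t: "t \<ge> 0" "t *\<^sub>R v + x \<in> K" "t *\<^sub>R v - x \<in> K" by (auto simp: V_def)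
    have "\<bar>c\<bar> *\<^sub>R (t *\<^sub>R v + x) \<in> K" "\<bar>c\<bar> *\<^sub>R (t *\<^sub>R v - x) \<in> K"
      using t K by (auto intro: convex_cone_scaleR)
    then show "c *\<^sub>R x \<in> V"
      using t(1) by (intro VI[of "\<bar>c\<bar> * t"]) (auto simp: algebra_simps minus_diff_commute abs_if split: if_splits)
  qed
  moreover have "B *v x \<in> V" if B: "B \<in> F" and "x \<in> V" for B x
  proof -
    from \<open>x \<in> V\<close> obtain t where t: "t \<ge> 0" "t *\<^sub>R v + x \<in> K" "t *\<^sub>R v - x \<in> K" by (auto simp: V_def)
    \<comment> \<open>\<open>B v \<le> r v\<close> in the order of \<open>K\<close>, since the other summands of \<open>sum_action F v\<close> lie in \<open>K\<close>.\<close>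
    have "r *\<^sub>R v - B *v v = (\<Sum>B'\<in>F - {B}. B' *v v)"
      using v(4) B fin by (simp add: sum_action_def sum_diff1)
    also have "\<dots> \<in> K" using K FK v(1) by (intro convex_cone_sum) auto
    finally have "t *\<^sub>R (r *\<^sub>R v - B *v v) \<in> K"
      using K t(1) by (intro convex_cone_scaleR)
    then have "t *\<^sub>R (r *\<^sub>R v - B *v v) + B *v (t *\<^sub>R v + x) \<in> K"
      "t *\<^sub>R (r *\<^sub>R v - B *v v) + B *v (t *\<^sub>R v - x) \<in> K"
      using K FK B t by (auto intro: convex_cone_add)
    then show ?thesis
      using t(1) v(3)
      by (intro VI[of "t * r"]) (simp_all add: algebra_simps matrix_vector_mult_scaleR)
  qed
  moreover have "v \<in> V"
  proof (rule VI[of 1])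
    have "2 *\<^sub>R v \<in> K" using K v(1) by (intro convex_cone_scaleR) auto
    then show "1 *\<^sub>R v + v \<in> K" by (simp add: scaleR_2)
  qed (use convex_cone_contains_0[OF K] in simp_all)
  ultimately have "V = UNIV" using irreducible_familyD[OF irr, of V] v(2) by blast
  then obtain t where t: "t \<ge> 0" "t *\<^sub>R v + x \<in> K" by (auto simp: V_def)
  then have "v + (t *\<^sub>R v + x) \<in> K" using convex_cone_add[OF K v(1)] by blast
  then have "(t + 1) *\<^sub>R v + x \<in> K" by (simp add: algebra_simps)
  then show thesis using t(1) that[of "t + 1"] by simp
qed

text \<open>
  If the ray from \<open>v\<close> in direction \<open>-w\<close> stayed in the closed cone arbitrarily far out, its
  limiting direction \<open>-w\<close> would belong to the cone.
\<close>

lemma closed_cone_last_exit: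
  fixes v w :: "'a :: real_normed_vector"
  assumes K: "closed K" "convex_cone K" and v: "v \<in> K" and w: "- w \<notin> K"
  obtains s where "s \<ge> 0" "v - s *\<^sub>R w \<in> K" "\<And>s'. v - s' *\<^sub>R w \<in> K \<Longrightarrow> s' \<le> s"
proof -
  define S where "S = {s. 0 \<le> s} \<inter> (\<lambda>s. v - s *\<^sub>R w) -` K"
  obtain e where e: "e > 0" "ball (- w) e \<subseteq> - K"
    using K(1) w by (metis ComplI open_Compl open_contains_ball)
  have bd: "s \<le> norm v / e + 1" if "v - s *\<^sub>R w \<in> K" for s
  proof (rule ccontr)
    assume s: "\<not> s \<le> norm v / e + 1"
    have "norm v / e \<ge> 0" using e(1) by simp
    then have "s > 0" using s by linarith
    have "norm v < s * e" using s e(1) by (simp add: field_simps)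
    have "(1 / s) *\<^sub>R (v - s *\<^sub>R w) \<in> K"
      using K(2) that \<open>s > 0\<close> by (intro convex_cone_scaleR) auto
    then have "(1 / s) *\<^sub>R v - w \<in> K" using \<open>s > 0\<close> by (simp add: algebra_simps)
    moreover have "(1 / s) *\<^sub>R v - w \<in> ball (- w) e"
      using \<open>s > 0\<close> \<open>norm v < s * e\<close> by (simp add: dist_norm field_simps)
    ultimately show False using e(2) by blast
  qed
  have "closed S" unfolding S_def
    by (intro closed_Int continuous_closed_vimage K(1))
      (auto intro!: continuous_intros simp: closed_Collect_le)
  moreover have "bounded S"
    unfolding bounded_iff using bd by (intro exI[of _ "norm v / e + 1"]) (auto simp: S_def)
  ultimately have "compact S" by (simp add: compact_eq_bounded_closed)
  moreover have S0: "0 \<in> S" using v by (simp add: S_def)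
  ultimately obtain s where s: "s \<in> S" "\<And>s'. s' \<in> S \<Longrightarrow> s' \<le> s"
    using compact_attains_sup[of S] by blast
  show thesis
  proof
    show "s \<ge> 0" "v - s *\<^sub>R w \<in> K" using s(1) by (auto simp: S_def)
    fix s' assume "v - s' *\<^sub>R w \<in> K"
    then show "s' \<le> s" using s S0 by (cases "s' \<ge> 0") (force simp: S_def)+
  qed
qed

text \<open>
  Let \<open>u = v - s w\<close> be the last point of \<open>K\<close> on the ray from \<open>v\<close> in direction \<open>-w\<close>. Its
  image under the sum of \<open>F\<close> is \<open>r v - s r' w\<close>, which again lies in \<open>K\<close>. After division by
  \<open>r\<close>, the inequality \<open>r' > r\<close> would contradict the maximality of \<open>s\<close>; for \<open>r = 0\<close> it would
  put \<open>-w\<close> into \<open>K\<close>. If \<open>r' = r\<close>, then \<open>u\<close> is itself an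
  eigenvector in \<open>K\<close>. Were it nonzero, it would be an order unit and one could go further in
  direction \<open>-w\<close>; hence \<open>u = 0\<close>.
\<close>

lemma Perron_eigenvalue_dominates:
  assumes K: "proper_cone K" and FK: "\<forall>B\<in>F. \<forall>x\<in>K. B *v x \<in> K"
    and fin: "finite F" and irr: "irreducible_family F"
    and v: "v \<in> K" "v \<noteq> 0" "r \<ge> 0" "sum_action F v = r *\<^sub>R v"
    and w: "- w \<notin> K" "r' \<ge> 0" "sum_action F w = r' *\<^sub>R w"
  shows "r' \<le> r" and "r' = r \<Longrightarrow> \<exists>s>0. v = s *\<^sub>R w"
proof -
  note cone = proper_cone_convex_cone[OF K]
  note unit = Perron_eigenvector_order_unit[OF cone FK fin irr]
  obtain s where s: "s \<ge> 0" "v - s *\<^sub>R w \<in> K" and smax: "\<And>s'. v - s' *\<^sub>R w \<in> K \<Longrightarrow> s' \<le> s"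
    using closed_cone_last_exit[OF proper_cone_closed[OF K] cone v(1) w(1)] by blast
  \<comment> \<open>The ray stays in \<open>K\<close> for a positive time because \<open>v\<close> is an order unit.\<close>
  have "s > 0"
  proof -
    obtain t where t: "t > 0" "t *\<^sub>R v + (- w) \<in> K" using unit v .
    then have "(1 / t) *\<^sub>R (t *\<^sub>R v + (- w)) \<in> K"
      using cone by (intro convex_cone_scaleR) auto
    then have "v - (1 / t) *\<^sub>R w \<in> K" using t(1) by (simp add: algebra_simps)
    then have "1 / t \<le> s" by (rule smax)
    then show ?thesis using t(1) by (smt (verit) divide_pos_pos)
  qed
  have act: "sum_action F (v - s *\<^sub>R w) = r *\<^sub>R v - (s * r') *\<^sub>R w"
    using linear_sum_action[of F] v(4) w(3) by (simp add: linear_diff linear_scale)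
  have "sum_action F (v - s *\<^sub>R w) \<in> K"
    unfolding sum_action_def using cone FK s(2) by (intro convex_cone_sum) auto
  then have img: "r *\<^sub>R v - (s * r') *\<^sub>R w \<in> K" using act by simp
  show "r' \<le> r"
  proof (cases "r = 0")
    case True
    show ?thesis
    proof (rule ccontr)
      assume "\<not> r' \<le> r"
      then have "(1 / (s * r')) *\<^sub>R (r *\<^sub>R v - (s * r') *\<^sub>R w) \<in> K"
        using img cone \<open>s > 0\<close> w(2) by (intro convex_cone_scaleR) auto
      then show False using True \<open>s > 0\<close> \<open>\<not> r' \<le> r\<close> w(1) by simp
    qed
  next
    case False
    then have "(1 / r) *\<^sub>R (r *\<^sub>R v - (s * r') *\<^sub>R w) \<in> K"
      using img cone v(3) by (intro convex_cone_scaleR) auto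
    then have "v - (s * r' / r) *\<^sub>R w \<in> K" using False by (simp add: algebra_simps)
    then have "s * r' / r \<le> s" by (rule smax)
    then show ?thesis using False v(3) \<open>s > 0\<close> by (simp add: field_simps)
  qed
  show "\<exists>s>0. v = s *\<^sub>R w" if "r' = r"
  proof (intro exI conjI)
    show "s > 0" by fact
    show "v = s *\<^sub>R w"
    proof (rule ccontr)
      define u where "u = v - s *\<^sub>R w"
      assume "v \<noteq> s *\<^sub>R w"
      then have "u \<noteq> 0" by (simp add: u_def)
      moreover have "sum_action F u = r *\<^sub>R u"
        using act that by (simp add: u_def algebra_simps)
      ultimately obtain t where t: "t > 0" "t *\<^sub>R u + (- w) \<in> K"
        using unit[of u r "- w"] s(2) v(3) unfolding u_def by metis
      then have "(1 / t) *\<^sub>R (t *\<^sub>R u + (- w)) \<in> K"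
        using cone by (intro convex_cone_scaleR) auto
      then have "v - (s + 1 / t) *\<^sub>R w \<in> K" using t(1) by (simp add: u_def algebra_simps)
      then have "s + 1 / t \<le> s" by (rule smax)
      then show False using t(1) by simp
    qed
  qed
qed

section \<open>Minimal and maximal cones\<close>

text \<open>
  Eigenvectors \<open>v\<close> and \<open>u\<close> of the same operator in two invariant cones dominate each other, so
  their eigenvalues agree and they are proportional. The domination lemma asks that the negative of
  the vector compared with the Perron vector lie outside the cone; as the cone is pointed, one of
  the two signs always achieves this.
\<close>

lemma common_vector_of_invariant_cones:
  assumes irr: "irreducible_family \<A>" and ex: "\<exists>K. invariant_cone \<A> K"
  obtains v where "v \<noteq> 0" "\<And>K. invariant_cone \<A> K \<Longrightarrow> v \<in> K \<or> - v \<in> K"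
proof -
  obtain F where F: "F \<subseteq> \<A>" "independent F" "\<A> \<subseteq> span F"
    using maximal_independent_subset by blast
  have fin: "finite F" using F(2) independent_bound by blast
  have irrF: "irreducible_family F" using irr F(3) by (rule irreducible_spanning_subset)
  have inv: "\<forall>B\<in>F. \<forall>x\<in>K. B *v x \<in> K" if "invariant_cone \<A> K" for K
    using that F(1) invariant_cone_mult by blast
  have eig: thesis
    if K: "invariant_cone \<A> K"
      and *: "\<And>v r. v \<in> K \<Longrightarrow> v \<noteq> 0 \<Longrightarrow> r \<ge> 0 \<Longrightarrow> sum_action F v = r *\<^sub>R v \<Longrightarrow> thesis"
    for K thesis
  proof (rule Perron_eigenvector_exists[OF invariant_cone_proper[OF K] linear_sum_action[of F]])
    show "sum_action F x \<in> K" if "x \<in> K" for x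
      unfolding sum_action_def
      using proper_cone_convex_cone[OF invariant_cone_proper[OF K]] inv[OF K] that
      by (intro convex_cone_sum) auto
  qed (fact *)
  note dom = Perron_eigenvalue_dominates[OF invariant_cone_proper inv fin irrF]
  obtain K0 where K0: "invariant_cone \<A> K0" using ex by blast
  obtain v r where v: "v \<in> K0" "v \<noteq> 0" "r \<ge> 0" "sum_action F v = r *\<^sub>R v"
    using eig[OF K0] .
  have sgn: "\<exists>w'\<in>{w, - w}. - w' \<notin> K" if "invariant_cone \<A> K" "w \<noteq> 0" for K w
    using proper_cone_pointed[OF invariant_cone_proper[OF that(1)], of w] that(2) by auto
  have neg: "sum_action F w' = c *\<^sub>R w'" if "sum_action F w = c *\<^sub>R w" "w' \<in> {w, - w}" for w w' c
    using that linear_neg[OF linear_sum_action[of F], of w] by auto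
  have "v \<in> K \<or> - v \<in> K" if K: "invariant_cone \<A> K" for K
  proof -
    obtain u q where u: "u \<in> K" "u \<noteq> 0" "q \<ge> 0" "sum_action F u = q *\<^sub>R u"
      using eig[OF K] .
    obtain u' where u': "u' \<in> {u, - u}" "- u' \<notin> K0" using sgn[OF K0 u(2)] by blast
    have "q \<le> r" using dom(1)[OF K0 K0 v u'(2) u(3) neg[OF u(4) u'(1)]] by blast
    obtain v' where v': "v' \<in> {v, - v}" "- v' \<notin> K" using sgn[OF K v(2)] by blast
    have "r \<le> q" using dom(1)[OF K K u v'(2) v(3) neg[OF v(4) v'(1)]] by blast
    with \<open>q \<le> r\<close> have "r = q" by simp
    then obtain s where s: "s > 0" "u = s *\<^sub>R v'"
      using dom(2)[OF K K u v'(2) v(3) neg[OF v(4) v'(1)]] by blast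
    have "(1 / s) *\<^sub>R u \<in> K"
      using s(1) u(1) proper_cone_convex_cone[OF invariant_cone_proper[OF K]]
      by (intro convex_cone_scaleR) auto
    then have "v' \<in> K" using s by simp
    then show ?thesis using v'(1) by auto
  qed
  with v(2) that show thesis by blast
qed

text \<open>
  Of every pair \<open>K, -K\<close> of invariant cones, a fixed common vector \<open>v\<close> selects the member that
  contains it. The intersection of the selected cones is the minimal cone; its span is a nonzero
  invariant subspace, which is why it has interior points.
\<close>

lemma minimal_invariant_cone_exists:
  assumes irr: "irreducible_family \<A>" and ex: "\<exists>K. invariant_cone \<A> K"
  shows "\<exists>K. minimal_invariant_cone \<A> K"
proof -
  obtain v where v: "v \<noteq> 0" "\<And>K. invariant_cone \<A> K \<Longrightarrow> v \<in> K \<or> - v \<in> K"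
    using common_vector_of_invariant_cones[OF assms] by blast
  define \<K> where "\<K> = {K. invariant_cone \<A> K \<and> v \<in> K}"
  have K: "closed K" "convex_cone K" "v \<in> K" if "K \<in> \<K>" for K
    using that invariant_cone_proper proper_cone_closed proper_cone_convex_cone
    unfolding \<K>_def by blast+
  have orient: "K \<in> \<K> \<or> uminus ` K \<in> \<K>" if "invariant_cone \<A> K" for K
    using v(2)[OF that] that invariant_cone_uminus by (auto simp: \<K>_def mem_uminus_image)
  have inv: "A *v x \<in> \<Inter>\<K>" if "A \<in> \<A>" "x \<in> \<Inter>\<K>" for A x
    using that invariant_cone_mult unfolding \<K>_def by blast
  have "invariant_cone \<A> (\<Inter>\<K>)"
  proof (rule invariant_coneI)
    show "proper_cone (\<Inter>\<K>)"
    proof (rule proper_coneI)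
      show "closed (\<Inter>\<K>)" using K(1) by blast
      show "convex_cone (\<Inter>\<K>)" using K(2) by (rule convex_cone_Inter)
      have "A *v x \<in> span (\<Inter>\<K>)" if "A \<in> \<A>" "x \<in> span (\<Inter>\<K>)" for A x
      proof -
        have "A *v x \<in> span ((*v) A ` \<Inter>\<K>)"
          using that(2) linear_span_image[OF matrix_vector_mul_linear, of A "\<Inter>\<K>"] by blast
        then show ?thesis using span_mono[of "(*v) A ` \<Inter>\<K>" "\<Inter>\<K>"] inv that(1) by blast
      qed
      moreover have "v \<in> span (\<Inter>\<K>)" using K(3) by (intro span_base) blast
      ultimately show "span (\<Inter>\<K>) = UNIV"
        using irreducible_familyD[OF irr subspace_span[of "\<Inter>\<K>"]] v(1) by blast
      obtain K1 where "K1 \<in> \<K>" using ex orient by blast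
      then show "x = 0" if "x \<in> \<Inter>\<K>" "- x \<in> \<Inter>\<K>" for x
        using that proper_cone_pointed[of K1 x] invariant_cone_proper unfolding \<K>_def by blast
    qed
  qed (rule inv)
  moreover have "\<Inter>\<K> \<subseteq> K \<or> \<Inter>\<K> \<subseteq> uminus ` K" if "invariant_cone \<A> K" for K
    using orient[OF that] by blast
  ultimately show ?thesis unfolding minimal_invariant_cone_def by blast
qed

lemma proper_cone_not_subset_uminus: "proper_cone K \<Longrightarrow> \<not> K \<subseteq> uminus ` K"
  using proper_cone_nontrivial proper_cone_pointed mem_uminus_image by (metis subsetD)

text \<open>
  Two minimal cones are each contained in the other up to sign. Opposite signs are impossible in
  these two inclusions, since a proper cone is not contained in its opposite.
\<close>

lemma minimal_invariant_cone_unique: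
  assumes K: "minimal_invariant_cone \<A> K"
  shows "minimal_invariant_cone \<A> L \<longleftrightarrow> L = K \<or> L = uminus ` K"
proof
  assume L: "minimal_invariant_cone \<A> L"
  have pr: "proper_cone K" "proper_cone L"
    using K L invariant_cone_proper by (auto simp: minimal_invariant_cone_def)
  have "K \<subseteq> L \<or> K \<subseteq> uminus ` L" "L \<subseteq> K \<or> L \<subseteq> uminus ` K"
    using K L by (auto simp: minimal_invariant_cone_def)
  moreover have "\<not> (K \<subseteq> L \<and> L \<subseteq> uminus ` K)" "\<not> (K \<subseteq> uminus ` L \<and> L \<subseteq> K)"
    using pr proper_cone_not_subset_uminus by blast+
  moreover have "K \<subseteq> uminus ` L \<Longrightarrow> uminus ` K \<subseteq> L"
    by (simp add: uminus_image_subset_iff)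
  ultimately show "L = K \<or> L = uminus ` K" by blast
next
  have "minimal_invariant_cone \<A> (uminus ` K)"
    using K invariant_cone_uminus uminus_image_subset_iff[of K]
    unfolding minimal_invariant_cone_def by (metis image_mono)
  then show "L = K \<or> L = uminus ` K \<Longrightarrow> minimal_invariant_cone \<A> L" using K by blast
qed

lemma transpose_image_transpose: "transpose ` transpose ` \<A> = \<A>"
  by (simp add: image_image)

lemma dual_dual_invariant_cone: "invariant_cone \<A> K \<Longrightarrow> dual_cone (dual_cone K) = K"
  by (simp add: dual_dual_cone invariant_cone_proper proper_cone_closed proper_cone_convex_cone)

text \<open>
  Dualising an inclusion reverses it, and the bidual returns the original cone, so the defining
  comparisons of maximality for the family and of minimality for the transposed family
  translate into each other.
\<close>

lemma maximal_iff_dual_minimal: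
  "maximal_invariant_cone \<A> K \<longleftrightarrow>
     (\<exists>M. minimal_invariant_cone (transpose ` \<A>) M \<and> K = dual_cone M)"
proof
  assume K: "maximal_invariant_cone \<A> K"
  then have invK: "invariant_cone \<A> K" by (simp add: maximal_invariant_cone_def)
  have "minimal_invariant_cone (transpose ` \<A>) (dual_cone K)"
    unfolding minimal_invariant_cone_def
  proof (intro conjI allI impI)
    show "invariant_cone (transpose ` \<A>) (dual_cone K)" using invK by (rule invariant_cone_dual)
    fix M assume M: "invariant_cone (transpose ` \<A>) M"
    have "invariant_cone \<A> (dual_cone M)"
      using invariant_cone_dual[OF M] by (simp add: transpose_image_transpose)
    then have "dual_cone M \<subseteq> K \<or> dual_cone (uminus ` M) \<subseteq> K"
      using K by (simp add: maximal_invariant_cone_def dual_cone_uminus)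
    then show "dual_cone K \<subseteq> M \<or> dual_cone K \<subseteq> uminus ` M"
      using dual_dual_invariant_cone[OF M] dual_dual_invariant_cone[OF invariant_cone_uminus[OF M]]
        dual_cone_antimono by metis
  qed
  then show "\<exists>M. minimal_invariant_cone (transpose ` \<A>) M \<and> K = dual_cone M"
    using dual_dual_invariant_cone[OF invK] by metis
next
  assume "\<exists>M. minimal_invariant_cone (transpose ` \<A>) M \<and> K = dual_cone M"
  then obtain M where M: "minimal_invariant_cone (transpose ` \<A>) M" and KM: "K = dual_cone M"
    by blast
  show "maximal_invariant_cone \<A> K"
    unfolding maximal_invariant_cone_def
  proof (intro conjI allI impI)
    have "invariant_cone (transpose ` \<A>) M" using M by (simp add: minimal_invariant_cone_def)
    from invariant_cone_dual[OF this] show "invariant_cone \<A> K"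
      by (simp add: KM transpose_image_transpose)
    fix L assume L: "invariant_cone \<A> L"
    have "M \<subseteq> dual_cone L \<or> M \<subseteq> dual_cone (uminus ` L)"
      using M invariant_cone_dual[OF L] by (simp add: minimal_invariant_cone_def dual_cone_uminus)
    then show "L \<subseteq> K \<or> uminus ` L \<subseteq> K"
      using dual_dual_invariant_cone[OF L] dual_dual_invariant_cone[OF invariant_cone_uminus[OF L]]
        dual_cone_antimono KM by metis
  qed
qed

theorem theorem2:
  fixes \<A> :: "(real ^ 'd ^ 'd) set"
  assumes "compact \<A>"
    and "irreducible_family \<A>"
    and "\<exists>K. invariant_cone \<A> K"
  shows "(\<exists>K. minimal_invariant_cone \<A> K \<and>
            (\<forall>L. minimal_invariant_cone \<A> L \<longleftrightarrow> L = K \<or> L = uminus ` K)) \<and>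
         (\<exists>K. maximal_invariant_cone \<A> K \<and>
            (\<forall>L. maximal_invariant_cone \<A> L \<longleftrightarrow> L = K \<or> L = uminus ` K)) \<and>
         (\<exists>K. minimal_invariant_cone (transpose ` \<A>) K) \<and>
         (\<forall>Kmax Kmin. maximal_invariant_cone \<A> Kmax \<longrightarrow>
            minimal_invariant_cone (transpose ` \<A>) Kmin \<longrightarrow>
            Kmax = dual_cone Kmin \<or> Kmax = uminus ` dual_cone Kmin)"
proof -
  have "\<exists>K. minimal_invariant_cone \<A> K"
    using assms(2,3) by (rule minimal_invariant_cone_exists)
  then have 1: "\<exists>K. minimal_invariant_cone \<A> K \<and>
      (\<forall>L. minimal_invariant_cone \<A> L \<longleftrightarrow> L = K \<or> L = uminus ` K)"
    using minimal_invariant_cone_unique by blast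
  have 2: "\<exists>M. minimal_invariant_cone (transpose ` \<A>) M"
    using assms(2,3) invariant_cone_dual irreducible_family_transpose
    by (intro minimal_invariant_cone_exists) blast+
  have 3: "maximal_invariant_cone \<A> L \<longleftrightarrow> L = dual_cone M \<or> L = uminus ` dual_cone M"
    if "minimal_invariant_cone (transpose ` \<A>) M" for L M
    unfolding maximal_iff_dual_minimal minimal_invariant_cone_unique[OF that]
    by (auto simp flip: dual_cone_uminus)
  obtain M where M: "minimal_invariant_cone (transpose ` \<A>) M" using 2 ..
  have "maximal_invariant_cone \<A> (dual_cone M)" by (simp add: 3[OF M])
  with 3[OF M] have 4: "\<exists>K. maximal_invariant_cone \<A> K \<and>
      (\<forall>L. maximal_invariant_cone \<A> L \<longleftrightarrow> L = K \<or> L = uminus ` K)"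
    by (intro exI[of _ "dual_cone M"]) simp
  show ?thesis
  proof (intro conjI allI impI)
    fix Kmax Kmin
    assume "maximal_invariant_cone \<A> Kmax" "minimal_invariant_cone (transpose ` \<A>) Kmin"
    then show "Kmax = dual_cone Kmin \<or> Kmax = uminus ` dual_cone Kmin" by (simp add: 3)
  qed (rule 1 2 4)+
qed

end
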